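(* Let $p=(p_{mn})_{m,n\ge 0}$ be a double sequence of nonnegative real numbers with $p_{00}>0$ such that $\sum_{k,l=0}^{m,n}p_{kl}\to\infty$ as $m,n\to\infty$ and such that $p(r,s)=\sum_{m,n=0}^{\infty}p_{mn}r^ms^n$ converges for all $r,s\in(0,1)$. Let $(L_{mn})_{m,n\ge 0}$ be a double sequence of positive linear operators from $C^*(\mathbb{R}^2)$ into $C^*(\mathbb{R}^2)$ such that, with $f_0(x,y)=1$, $$\sum_{m,n=0}^{\infty}\Vert L_{mn}(f_0)\Vert_{C^*(\mathbb{R}^2)}\,p_{mn}r^ms^n<\infty\qquad\text{for every } r,s\in(0,1).$$ For $(x,y)\in\mathbb{R}^2$ let $\varphi_{x,y}\in C^*(\mathbb{R}^2)$ be $\varphi_{x,y}(u,v)=\sin^2\left(\frac{u-x}{2}\right)+\sin^2\left(\frac{v-y}{2}\right)$, and for $r,s\in(0,1)$ put $$\gamma(r,s)=\sqrt{\sup_{(x,y)\in\mathbb{R}^2}\left|\frac{1}{p(r,s)}\sum_{m,n=0}^{\infty}L_{mn}(\varphi_{x,y};x,y)\,p_{mn}r^ms^n\right|}.$$ Then for all $f\in C^*(\mathbb{R}^2)$: if (i) $L_{mn}(f_0)\to f_0\ (J_p)$, and (ii) $\lim_{r,s\to1^-}\omega(f;\gamma(r,s))=0$, then $L_{mn}(f)\to f\ (J_p)$.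
   Context: $C^*(\mathbb{R}^2)$ denotes the space of continuous functions $f:\mathbb{R}^2\to\mathbb{R}$ that are $2\pi$-periodic in each variable, i.e. $f(x,y)=f(x+2k\pi,y)=f(x,y+2k\pi)$ for all $(x,y)\in\mathbb{R}^2$ and $k\in\mathbb{Z}$, with the norm $\Vert f\Vert_{C^*(\mathbb{R}^2)}=\sup_{(x,y)\in\mathbb{R}^2}|f(x,y)|$. A linear operator $L:C^*(\mathbb{R}^2)\to C^*(\mathbb{R}^2)$ is positive if $f\ge 0$ implies $L(f)\ge 0$. $L_{mn}(g;x,y)$ denotes the value of $L_{mn}(g)$ at $(x,y)$; in $L_{mn}(\varphi_{x,y};x,y)$ the operator acts on the function $(u,v)\mapsto\varphi_{x,y}(u,v)$ with $(x,y)$ fixed, and the result is evaluated at that same point $(x,y)$. Convergence of double sequences and double series is in Pringsheim's sense: $a_{mn}\to a$ if for every $\varepsilon>0$ there is $N$ with $|a_{mn}-a|<\varepsilon$ whenever $m,n\ge N$; a double series converges if its rectangular partial sums $\sum_{k,l=0}^{m,n}$ converge in this sense. For functions $g_{mn},g\in C^*(\mathbb{R}^2)$, $g_{mn}\to g\ (J_p)$ (summability by the power series method determined by $p$, taken in norm) means $$\lim_{r,s\to1^-}\left\Vert\frac{1}{p(r,s)}\sum_{m,n=0}^{\infty}g_{mn}\,p_{mn}r^ms^n-g\right\Vert_{C^*(\mathbb{R}^2)}=0,$$ where $r,s\in(0,1)$ tend to $1$ jointly and independently. Under the summability hypothesis on $\Vert L_{mn}(f_0)\Vert_{C^*(\mathbb{R}^2)}$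 in the claim, for each $f\in C^*(\mathbb{R}^2)$ the series $\sum_{m,n=0}^\infty L_{mn}(f;x,y)p_{mn}r^ms^n$ converges for all $r,s\in(0,1)$. The modulus of continuity of $f\in C^*(\mathbb{R}^2)$ is $$\omega(f;\delta)=\sup\left\{|f(u,v)-f(x,y)|:\ (u,v),(x,y)\in\mathbb{R}^2,\ \sqrt{(u-x)^2+(v-y)^2}\le\delta\right\}$$ for $\delta>0$, and $\omega(f;0)=0$ (the same formula at $\delta=0$). *)

theory Defs
  imports "HOL-Analysis.Analysis"
begin

section \<open>Double series in Pringsheim's sense\<close>

definition dpartial :: "(nat \<Rightarrow> nat \<Rightarrow> real) \<Rightarrow> nat \<times> nat \<Rightarrow> real" where
  "dpartial a = (\<lambda>(m, n). \<Sum>k\<le>m. \<Sum>l\<le>n. a k l)"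

text \<open>A property holds eventually along the product filter below iff there is \<open>N\<close> such that it
  holds for all \<open>(m, n)\<close> with \<open>m, n \<ge> N\<close>; see \<open>eventually_prod_sequentially\<close>.\<close>

definition dsums :: "(nat \<Rightarrow> nat \<Rightarrow> real) \<Rightarrow> real \<Rightarrow> bool" where
  "dsums a S \<longleftrightarrow> (dpartial a \<longlongrightarrow> S) (sequentially \<times>\<^sub>F sequentially)"

definition dsummable :: "(nat \<Rightarrow> nat \<Rightarrow> real) \<Rightarrow> bool" where
  "dsummable a \<longleftrightarrow> (\<exists>S. dsums a S)"

definition dsuminf :: "(nat \<Rightarrow> nat \<Rightarrow> real) \<Rightarrow> real" where
  "dsuminf a = (THE S. dsums a S)"

section \<open>The space of continuous doubly periodic functions\<close>

definition Cstar :: "(real \<times> real \<Rightarrow> real) set" where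
  "Cstar = {f. continuous_on UNIV f \<and>
     (\<forall>x y. \<forall>k::int. f (x, y) = f (x + 2 * of_int k * pi, y) \<and>
                     f (x, y) = f (x, y + 2 * of_int k * pi))}"

definition Cstar_norm :: "(real \<times> real \<Rightarrow> real) \<Rightarrow> real" where
  "Cstar_norm f = (SUP z. \<bar>f z\<bar>)"

text \<open>Operators on \<open>Cstar\<close> are total functions on \<open>real \<times> real \<Rightarrow> real\<close>; their values outside
  \<open>Cstar\<close> are left unconstrained.\<close>

definition positive_linear_operator ::
    "((real \<times> real \<Rightarrow> real) \<Rightarrow> (real \<times> real \<Rightarrow> real)) \<Rightarrow> bool" where
  "positive_linear_operator T \<longleftrightarrow>
     (\<forall>f\<in>Cstar. T f \<in> Cstar) \<and>
     (\<forall>f\<in>Cstar. \<forall>g\<in>Cstar. T (\<lambda>z. f z + g z) = (\<lambda>z. T f z + T g z)) \<and>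
     (\<forall>f\<in>Cstar. \<forall>c. T (\<lambda>z. c * f z) = (\<lambda>z. c * T f z)) \<and>
     (\<forall>f\<in>Cstar. (\<forall>z. 0 \<le> f z) \<longrightarrow> (\<forall>z. 0 \<le> T f z))"

definition modulus :: "(real \<times> real \<Rightarrow> real) \<Rightarrow> real \<Rightarrow> real" where
  "modulus f \<delta> =
     Sup {\<bar>f (u, v) - f (x, y)\<bar> | u v x y. sqrt ((u - x)\<^sup>2 + (v - y)\<^sup>2) \<le> \<delta>}"

section \<open>The power series method\<close>

definition dpower :: "(nat \<Rightarrow> nat \<Rightarrow> real) \<Rightarrow> real \<Rightarrow> real \<Rightarrow> real" where
  "dpower p r s = dsuminf (\<lambda>m n. p m n * r ^ m * s ^ n)"

definition Jp_mean ::
    "(nat \<Rightarrow> nat \<Rightarrow> real) \<Rightarrow> (nat \<Rightarrow> nat \<Rightarrow> real \<times> real \<Rightarrow> real) \<Rightarrow> real \<Rightarrow> real \<Rightarrow> real \<times> real \<Rightarrow> real" where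
  "Jp_mean p g r s = (\<lambda>z. 1 / dpower p r s * dsuminf (\<lambda>m n. g m n z * p m n * r ^ m * s ^ n))"

text \<open>The first conjunct says that the expression under the limit is meaningful: the series
  converges and the mean belongs to \<open>Cstar\<close>, so that neither \<open>dsuminf\<close> nor the supremum in
  \<open>Cstar_norm\<close> takes an unspecified value.  The filter \<open>at_left 1 \<times>\<^sub>F at_left 1\<close> is the joint,
  independent limit \<open>r, s \<rightarrow> 1-\<close>.\<close>

definition Jp_summable ::
    "(nat \<Rightarrow> nat \<Rightarrow> real) \<Rightarrow> (nat \<Rightarrow> nat \<Rightarrow> real \<times> real \<Rightarrow> real) \<Rightarrow> (real \<times> real \<Rightarrow> real) \<Rightarrow> bool" where
  "Jp_summable p g G \<longleftrightarrow>
     (\<forall>r\<in>{0<..<1}. \<forall>s\<in>{0<..<1}.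
        (\<forall>z. dsummable (\<lambda>m n. g m n z * p m n * r ^ m * s ^ n)) \<and> Jp_mean p g r s \<in> Cstar) \<and>
     ((\<lambda>(r, s). Cstar_norm (\<lambda>z. Jp_mean p g r s z - G z)) \<longlongrightarrow> 0) (at_left 1 \<times>\<^sub>F at_left 1)"

definition phi :: "real \<Rightarrow> real \<Rightarrow> real \<times> real \<Rightarrow> real" where
  "phi x y = (\<lambda>(u, v). (sin ((u - x) / 2))\<^sup>2 + (sin ((v - y) / 2))\<^sup>2)"

definition gamma_rs ::
    "(nat \<Rightarrow> nat \<Rightarrow> real) \<Rightarrow> (nat \<Rightarrow> nat \<Rightarrow> (real \<times> real \<Rightarrow> real) \<Rightarrow> (real \<times> real \<Rightarrow> real))
      \<Rightarrow> real \<Rightarrow> real \<Rightarrow> real" where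
  "gamma_rs p L r s = sqrt (SUP (x, y).
     \<bar>1 / dpower p r s * dsuminf (\<lambda>m n. L m n (phi x y) (x, y) * p m n * r ^ m * s ^ n)\<bar>)"

end

theory Submission
  imports Defs
begin

text \<open>For \<open>r, s\<close> fixed, the normalised power series \<open>T f = Jp_mean p (\<lambda>m n. L m n f) r s\<close> is again a
  positive linear operator on \<open>Cstar\<close>, because its terms are dominated by those for \<open>f = 1\<close>.  The
  theorem thus reduces to a Korovkin estimate for a single positive operator \<open>T\<close>.  After a shift by
  periods, \<open>\<bar>f w - f z\<bar> \<le> (1 + pi\<^sup>2 * phi z w / \<delta>\<^sup>2) * modulus f \<delta>\<close>; applying \<open>T\<close>, evaluating at \<open>z\<close>
  and choosing for \<open>\<delta>\<close> the quantity \<open>\<gamma>\<close> of the theorem bounds \<open>\<bar>T f z - f z * T 1 z\<bar>\<close> by a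
  multiple of \<open>modulus f \<gamma>\<close>.  The case \<open>\<gamma> = 0\<close>, where this choice is not possible, is treated with
  \<open>\<bar>f w - f z\<bar> \<le> \<epsilon> + C * phi z w\<close> for arbitrary \<open>\<epsilon>\<close>.\<close>

section \<open>Double series and unconditional summation\<close>

text \<open>Rectangles eventually swallow every finite index set. This turns limits over finite
  sets, which is how \<open>has_sum\<close> is defined, into Pringsheim limits.\<close>

lemma filterlim_rectangles:
  "filterlim (\<lambda>(m, n). {..m} \<times> {..n}) (finite_subsets_at_top (UNIV :: (nat \<times> nat) set))
     (sequentially \<times>\<^sub>F sequentially)"
  unfolding filterlim_iff
proof (intro allI impI)
  fix P assume "eventually P (finite_subsets_at_top (UNIV :: (nat \<times> nat) set))"
  then obtain X where X: "finite X" "\<And>Y. finite Y \<Longrightarrow> X \<subseteq> Y \<Longrightarrow> P Y"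
    by (auto simp: eventually_finite_subsets_at_top)
  \<comment> \<open>Inserting \<open>0\<close> keeps the maximum meaningful when \<open>X\<close> is
    empty.\<close>
  define N where "N = Max (insert 0 (fst ` X \<union> snd ` X))"
  have "a \<le> N \<and> b \<le> N" if "(a, b) \<in> X" for a b
    using that X(1) unfolding N_def by (auto intro!: Max_ge intro: rev_image_eqI)
  then have "X \<subseteq> {..m} \<times> {..n}" if "m \<ge> N" "n \<ge> N" for m n
    using that by (auto intro: order_trans)
  \<comment> \<open>The swapped indices match the quantifier order in
    \<open>eventually_prod_sequentially\<close>.\<close>
  then have "\<forall>m\<ge>N. \<forall>n\<ge>N. P ({..n} \<times> {..m})"
    by (intro allI impI X(2)) auto
  then show "\<forall>\<^sub>F x in sequentially \<times>\<^sub>F sequentially. P (case x of (m, n) \<Rightarrow> {..m} \<times> {..n})"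
    unfolding eventually_prod_sequentially by (intro exI[of _ N]) auto
qed

lemma sequentially_prod_neq_bot [simp]:
  "sequentially \<times>\<^sub>F sequentially \<noteq> (bot :: (nat \<times> nat) filter)"
  by (simp add: prod_filter_eq_bot)

lemma dpartial_eq_sum:
  "dpartial a x = sum (\<lambda>(m, n). a m n) ((\<lambda>(m, n). {..m} \<times> {..n}) x)"
  by (cases x) (simp add: dpartial_def sum.cartesian_product)

lemma has_sum_imp_dsums:
  assumes "((\<lambda>(m, n). a m n) has_sum S) UNIV"
  shows "dsums a S"
proof -
  have "((\<lambda>x. sum (\<lambda>(m, n). a m n) ((\<lambda>(m, n). {..m} \<times> {..n}) x)) \<longlongrightarrow> S)
      (sequentially \<times>\<^sub>F sequentially)"
    using assms filterlim_rectangles unfolding has_sum_def by (rule filterlim_compose)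
  then show ?thesis
    unfolding dsums_def dpartial_eq_sum[symmetric] .
qed

lemma dsums_imp_dsuminf:
  assumes "dsums a S"
  shows "dsuminf a = S"
  unfolding dsuminf_def
  using assms tendsto_unique[OF sequentially_prod_neq_bot] unfolding dsums_def by blast

text \<open>Every finite partial sum is eventually below a rectangular one, hence below the
  Pringsheim limit. For terms of mixed sign this implication fails, so it is applied only to
  \<open>p\<close> and to the norms of the \<open>L m n (\<lambda>_. 1)\<close>.\<close>

lemma dsummable_nonneg_imp_summable_on:
  assumes "dsummable a" and nonneg: "\<And>m n. 0 \<le> a m n"
  shows "(\<lambda>(m, n). a m n) summable_on UNIV"
proof (rule nonneg_bdd_above_summable_on)
  obtain S where S: "(dpartial a \<longlongrightarrow> S) (sequentially \<times>\<^sub>F sequentially)"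
    using assms(1) by (auto simp: dsummable_def dsums_def)
  have "sum (\<lambda>(m, n). a m n) F \<le> S" if "finite F" for F
  proof (rule tendsto_lowerbound[OF S])
    have "\<forall>\<^sub>F Y in finite_subsets_at_top UNIV. sum (\<lambda>(m, n). a m n) F \<le> sum (\<lambda>(m, n). a m n) Y"
      unfolding eventually_finite_subsets_at_top using that nonneg
      by (intro exI[of _ F]) (auto intro!: sum_mono2)
    then show "\<forall>\<^sub>F x in sequentially \<times>\<^sub>F sequentially. sum (\<lambda>(m, n). a m n) F \<le> dpartial a x"
      using filterlim_rectangles unfolding filterlim_iff dpartial_eq_sum by blast
  qed simp
  then show "bdd_above (sum (\<lambda>(m, n). a m n) ` {F. F \<subseteq> UNIV \<and> finite F})"
    by (auto intro!: bdd_aboveI)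
qed (auto simp: nonneg)

section \<open>Doubly periodic functions\<close>

lemma Cstar_shift:
  assumes "f \<in> Cstar"
  shows "f (x + 2 * of_int k * pi, y + 2 * of_int l * pi) = f (x, y)"
  using assms unfolding Cstar_def by (metis (mono_tags, lifting) mem_Collect_eq)

lemma Cstar_continuous: "f \<in> Cstar \<Longrightarrow> continuous_on A f"
  unfolding Cstar_def using continuous_on_subset by blast

lemma CstarI:
  assumes "continuous_on UNIV f"
    and "\<And>x y k l. f (x + 2 * of_int k * pi, y + 2 * of_int l * pi) = f (x, y)"
  shows "f \<in> Cstar"
  using assms(1) assms(2)[where k = 0] assms(2)[where l = 0] unfolding Cstar_def by simp

lemma Cstar_const: "(\<lambda>_. c) \<in> Cstar"
  by (rule CstarI) auto

lemma Cstar_add: "f \<in> Cstar \<Longrightarrow> g \<in> Cstar \<Longrightarrow> (\<lambda>z. f z + g z) \<in> Cstar"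
  by (rule CstarI) (simp_all add: Cstar_shift Cstar_continuous continuous_on_add)

lemma Cstar_cmult: "f \<in> Cstar \<Longrightarrow> (\<lambda>z. c * f z) \<in> Cstar"
  by (rule CstarI) (simp_all add: Cstar_shift Cstar_continuous continuous_on_mult_left)

lemma Cstar_diff: "f \<in> Cstar \<Longrightarrow> g \<in> Cstar \<Longrightarrow> (\<lambda>z. f z - g z) \<in> Cstar"
  by (rule CstarI) (simp_all add: Cstar_shift Cstar_continuous continuous_on_diff)

text \<open>A full period in \<open>u\<close> shifts the half angle by a multiple of
  \<open>pi\<close>, which changes the sine only by a sign.\<close>

lemma sin_squared_half_shift:
  "(sin ((u + 2 * of_int k * pi - x) / 2))\<^sup>2 = (sin ((u - x) / 2))\<^sup>2"
proof -
  have 1: "(u + 2 * of_int k * pi - x) / 2 = (u - x) / 2 + of_int k * pi"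
    by (simp add: field_simps)
  have 2: "sin (of_int k * pi) = 0"
    by (metis sin_zero_iff_int2)
  have "(cos (of_int k * pi))\<^sup>2 = 1"
    using 2 sin_cos_squared_add[of "of_int k * pi"] by simp
  then show ?thesis
    unfolding 1 sin_add 2 by (simp add: power_mult_distrib)
qed

lemma phi_Cstar: "phi x y \<in> Cstar"
proof (rule CstarI)
  show "continuous_on UNIV (phi x y)"
    unfolding phi_def case_prod_unfold by (intro continuous_intros) auto
qed (simp add: phi_def sin_squared_half_shift)

lemma phi_nonneg: "0 \<le> phi x y w"
  by (simp add: phi_def case_prod_unfold)

lemma phi_le_2: "phi x y w \<le> 2"
  unfolding phi_def case_prod_unfold
  using sin_squared_eq by (smt (verit, best) zero_le_power2)

section \<open>Comparison of \<open>phi\<close> with the squared distance modulo periods\<close>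

lemma period_shift_near:
  obtains k :: int where "\<bar>u + 2 * of_int k * pi - x\<bar> \<le> pi"
proof
  \<comment> \<open>The nearest integer leaves an error of at most \<open>1 / 2\<close>, that is,
    half a period.\<close>
  define k where "k = round ((x - u) / (2 * pi))"
  have "\<bar>of_int k - (x - u) / (2 * pi)\<bar> \<le> 1 / 2"
    unfolding k_def by (rule of_int_round_abs_le)
  then have "2 * pi * \<bar>of_int k - (x - u) / (2 * pi)\<bar> \<le> 2 * pi * (1 / 2)"
    by (intro mult_left_mono) auto
  moreover have "2 * pi * \<bar>of_int k - (x - u) / (2 * pi)\<bar> = \<bar>2 * pi * (of_int k - (x - u) / (2 * pi))\<bar>"
    by (simp add: abs_mult)
  moreover have "2 * pi * (of_int k - (x - u) / (2 * pi)) = u + 2 * of_int k * pi - x"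
    by (simp add: field_simps)
  ultimately show "\<bar>u + 2 * of_int k * pi - x\<bar> \<le> pi"
    by simp
qed

text \<open>Jordan's inequality: by concavity the sine lies above its chord from the origin to
  \<open>(pi / 2, 1)\<close>.\<close>

lemma sin_ge_chord:
  assumes "0 \<le> t" "t \<le> pi / 2"
  shows "2 * t / pi \<le> sin t"
proof -
  have "concave_on {0..pi / 2} sin"
    by (rule f''_le0_imp_concave[where f' = cos and f'' = "\<lambda>x. - sin x"])
      (auto intro!: derivative_eq_intros sin_ge_zero)
  from concave_onD[OF this, of "2 * t / pi" 0 "pi / 2"] show ?thesis
    using assms by (simp add: field_simps)
qed

lemma abs_le_pi_sin_half:
  assumes "\<bar>d\<bar> \<le> pi"
  shows "d\<^sup>2 \<le> pi\<^sup>2 * (sin (d / 2))\<^sup>2"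
proof -
  have "2 * (\<bar>d\<bar> / 2) / pi \<le> sin (\<bar>d\<bar> / 2)"
    using assms by (intro sin_ge_chord) auto
  then have "\<bar>d\<bar> \<le> pi * sin (\<bar>d\<bar> / 2)"
    by (simp add: field_simps)
  then have "\<bar>d\<bar>\<^sup>2 \<le> (pi * sin (\<bar>d\<bar> / 2))\<^sup>2"
    by (intro power_mono) auto
  moreover have "(sin (\<bar>d\<bar> / 2))\<^sup>2 = (sin (d / 2))\<^sup>2"
    by (cases "d \<ge> 0") auto
  ultimately show ?thesis
    by (simp add: power_mult_distrib)
qed

text \<open>Each coordinate is moved by periods to within \<open>pi\<close> of \<open>x\<close> or
  \<open>y\<close>. Neither \<open>f\<close> nor \<open>phi\<close> notices the shift, and at this
  range Jordan's inequality bounds the squared distance by \<open>phi\<close>. The last conclusion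
  reduces boundedness of \<open>f\<close> to a compact square.\<close>

lemma Cstar_representative:
  assumes "f \<in> Cstar"
  obtains w' where "f w' = f w" and "(dist w' (x, y))\<^sup>2 \<le> pi\<^sup>2 * phi x y w"
    and "w' \<in> {x - pi..x + pi} \<times> {y - pi..y + pi}"
proof -
  obtain u v where w: "w = (u, v)" by (cases w)
  obtain k l :: int where k: "\<bar>u + 2 * of_int k * pi - x\<bar> \<le> pi"
    and l: "\<bar>v + 2 * of_int l * pi - y\<bar> \<le> pi"
    using period_shift_near by metis
  show ?thesis
  proof
    let ?w = "(u + 2 * of_int k * pi, v + 2 * of_int l * pi)"
    show "f ?w = f w"
      using assms w by (simp add: Cstar_shift)
    show "(dist ?w (x, y))\<^sup>2 \<le> pi\<^sup>2 * phi x y w"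
      using abs_le_pi_sin_half[OF k] abs_le_pi_sin_half[OF l]
      unfolding w phi_def sin_squared_half_shift
      by (simp add: dist_Pair_Pair dist_real_def distrib_left)
    show "?w \<in> {x - pi..x + pi} \<times> {y - pi..y + pi}"
      using k l by auto
  qed
qed

lemma Cstar_bounded:
  assumes "f \<in> Cstar"
  shows "bdd_above (range (\<lambda>z. \<bar>f z\<bar>))"
proof -
  \<comment> \<open>Written with \<open>0\<close> so as to match \<open>Cstar_representative\<close>
    at the origin.\<close>
  let ?K = "{0 - pi..0 + pi} \<times> {0 - pi..0 + pi}"
  have "compact (f ` ?K)"
    by (intro compact_continuous_image compact_Times Cstar_continuous assms) auto
  then obtain B where B: "\<And>w. w \<in> ?K \<Longrightarrow> \<bar>f w\<bar> \<le> B"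
    unfolding compact_eq_bounded_closed bounded_iff by (metis image_eqI real_norm_def)
  have "\<bar>f w\<bar> \<le> B" for w
    using Cstar_representative[OF assms, of w 0 0] B by metis
  then show ?thesis
    by (auto intro!: bdd_aboveI)
qed

section \<open>The supremum norm\<close>

lemma Cstar_norm_upper: "f \<in> Cstar \<Longrightarrow> \<bar>f z\<bar> \<le> Cstar_norm f"
  unfolding Cstar_norm_def by (intro cSUP_upper Cstar_bounded) auto

lemma Cstar_norm_least: "(\<And>z. \<bar>f z\<bar> \<le> C) \<Longrightarrow> Cstar_norm f \<le> C"
  unfolding Cstar_norm_def by (intro cSUP_least) auto

lemma Cstar_norm_nonneg: "f \<in> Cstar \<Longrightarrow> 0 \<le> Cstar_norm f"
  by (rule order_trans[OF abs_ge_zero Cstar_norm_upper])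

section \<open>The modulus of continuity\<close>

lemma modulus_upper:
  assumes "f \<in> Cstar" "dist w z \<le> \<delta>"
  shows "\<bar>f w - f z\<bar> \<le> modulus f \<delta>"
  unfolding modulus_def
proof (rule cSup_upper)
  show "\<bar>f w - f z\<bar> \<in> {\<bar>f (u, v) - f (x, y)\<bar> |u v x y. sqrt ((u - x)\<^sup>2 + (v - y)\<^sup>2) \<le> \<delta>}"
    using assms(2) by (cases w; cases z) (auto simp: dist_Pair_Pair dist_real_def)
  \<comment> \<open>A real \<open>Sup\<close> is an upper bound only for a set that is bounded
    above; boundedness of \<open>f\<close> provides this.\<close>
  have "\<bar>f a - f b\<bar> \<le> 2 * Cstar_norm f" for a b
    using Cstar_norm_upper[OF assms(1), of a] Cstar_norm_upper[OF assms(1), of b] by linarith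
  then show "bdd_above {\<bar>f (u, v) - f (x, y)\<bar> |u v x y. sqrt ((u - x)\<^sup>2 + (v - y)\<^sup>2) \<le> \<delta>}"
    by (auto intro!: bdd_aboveI)
qed

lemma modulus_nonneg: "f \<in> Cstar \<Longrightarrow> 0 \<le> \<delta> \<Longrightarrow> 0 \<le> modulus f \<delta>"
  \<comment> \<open>Any point serves here, taken for both arguments so that their distance is
    \<open>0\<close>.\<close>
  using modulus_upper[of f undefined undefined \<delta>] by simp

text \<open>The segment from \<open>z\<close> to \<open>w\<close> is cut into \<open>n\<close> equal
  pieces, each of length at most \<open>\<delta>\<close>.\<close>

lemma modulus_multiple:
  assumes "f \<in> Cstar" "dist w z \<le> real n * \<delta>"
  shows "\<bar>f w - f z\<bar> \<le> real n * modulus f \<delta>"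
  using assms(2)
proof (induction n arbitrary: w)
  case 0
  then show ?case by simp
next
  case (Suc n)
  \<comment> \<open>The last division point before \<open>w\<close>: one piece remains after it, and
    \<open>n\<close> pieces lead back to \<open>z\<close>.\<close>
  define w' where "w' = z + (real n / real (Suc n)) *\<^sub>R (w - z)"
  have d: "norm (w - z) / real (Suc n) \<le> \<delta>"
    using Suc.prems by (simp add: dist_norm field_simps)
  have "w - w' = (1 / real (Suc n)) *\<^sub>R (w - z)"
  proof -
    have "w - w' = (1 - real n / real (Suc n)) *\<^sub>R (w - z)"
      by (simp add: w'_def algebra_simps)
    then show ?thesis
      by (simp add: field_simps)
  qed
  then have "dist w w' \<le> \<delta>"
    using d by (simp add: dist_norm)
  then have 1: "\<bar>f w - f w'\<bar> \<le> modulus f \<delta>"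
    by (rule modulus_upper[OF assms(1)])
  have "dist w' z = real n * (norm (w - z) / real (Suc n))"
    by (simp add: w'_def dist_norm)
  also have "\<dots> \<le> real n * \<delta>"
    using d by (intro mult_left_mono) auto
  finally have "\<bar>f w' - f z\<bar> \<le> real n * modulus f \<delta>"
    by (rule Suc.IH)
  with 1 show ?case
    by (simp add: algebra_simps)
qed

lemma modulus_quadratic:
  assumes f: "f \<in> Cstar" and "0 < \<delta>"
  shows "\<bar>f w - f z\<bar> \<le> (1 + (dist w z)\<^sup>2 / \<delta>\<^sup>2) * modulus f \<delta>"
proof -
  define q where "q = dist w z / \<delta>"
  have q: "0 \<le> q" and qd: "dist w z = q * \<delta>"
    using assms by (auto simp: q_def)
  have "\<bar>f w - f z\<bar> \<le> (1 + q\<^sup>2) * modulus f \<delta>"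
  proof (cases "q \<le> 1")
    case True
    then have "dist w z \<le> \<delta>"
      using qd assms(2) by (simp add: mult_le_cancel_right1)
    then have "\<bar>f w - f z\<bar> \<le> 1 * modulus f \<delta>"
      using modulus_upper[OF f] by simp
    also have "\<dots> \<le> (1 + q\<^sup>2) * modulus f \<delta>"
      using modulus_nonneg[OF f] assms(2) by (intro mult_right_mono) auto
    finally show ?thesis .
  next
    case False
    \<comment> \<open>Rounding up costs at most \<open>1\<close>, and
      \<open>q \<le> q\<^sup>2\<close> since \<open>q > 1\<close>.\<close>
    define n where "n = nat \<lceil>q\<rceil>"
    have n: "q \<le> real n" "real n \<le> 1 + q"
      using q by (simp_all add: n_def real_nat_ceiling_ge) linarith
    have "dist w z \<le> real n * \<delta>"
      using n assms(2) unfolding qd by (intro mult_right_mono) auto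
    then have "\<bar>f w - f z\<bar> \<le> real n * modulus f \<delta>"
      by (rule modulus_multiple[OF f])
    also have "real n \<le> 1 + q\<^sup>2"
      using n(2) self_le_power[of q 2] False by simp
    then have "real n * modulus f \<delta> \<le> (1 + q\<^sup>2) * modulus f \<delta>"
      using modulus_nonneg[OF f] assms(2) by (intro mult_right_mono) auto
    finally show ?thesis .
  qed
  then show ?thesis
    by (simp add: q_def power_divide)
qed

text \<open>The quadratic estimate is applied to the representative of \<open>w\<close> nearest to
  \<open>(x, y)\<close>, where \<open>pi\<^sup>2 * phi x y w\<close> dominates the squared distance.
  Unlike that distance, \<open>phi x y\<close> lies in \<open>Cstar\<close>, so an operator can be
  applied to the bound.\<close>

lemma Cstar_phi_estimate:
  assumes f: "f \<in> Cstar" and "0 < \<delta>"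
  shows "\<bar>f w - f (x, y)\<bar> \<le> modulus f \<delta> + modulus f \<delta> * pi\<^sup>2 / \<delta>\<^sup>2 * phi x y w"
proof -
  obtain w' where w': "f w' = f w" "(dist w' (x, y))\<^sup>2 \<le> pi\<^sup>2 * phi x y w"
    using Cstar_representative[OF f] by metis
  have "\<bar>f w' - f (x, y)\<bar> \<le> (1 + (dist w' (x, y))\<^sup>2 / \<delta>\<^sup>2) * modulus f \<delta>"
    by (rule modulus_quadratic[OF assms])
  also have "\<dots> \<le> (1 + (pi\<^sup>2 * phi x y w) / \<delta>\<^sup>2) * modulus f \<delta>"
    using w'(2) modulus_nonneg[OF f] assms(2)
    by (intro mult_right_mono add_left_mono divide_right_mono) auto
  finally show ?thesis
    using w'(1) by (simp add: algebra_simps)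
qed

text \<open>Near \<open>(x, y)\<close> continuity gives \<open>\<epsilon>\<close>; away from it
  \<open>phi\<close> is bounded below, so a large multiple absorbs the crude bound
  \<open>2 * Cstar_norm f\<close>. The constant \<open>C\<close> may depend on the point, as it will
  be multiplied by zero or less.\<close>

lemma Cstar_phi_estimate_eps:
  assumes f: "f \<in> Cstar" and "0 < \<epsilon>"
  obtains C where "0 \<le> C" and "\<And>w. \<bar>f w - f (x, y)\<bar> \<le> \<epsilon> + C * phi x y w"
proof -
  have "isCont f (x, y)"
    using Cstar_continuous[OF f, of UNIV] by (simp add: continuous_on_eq_continuous_at)
  then obtain d where d: "d > 0" "\<And>w. dist w (x, y) < d \<Longrightarrow> \<bar>f w - f (x, y)\<bar> < \<epsilon>"
    using \<open>0 < \<epsilon>\<close> unfolding continuous_at_eps_delta by (metis dist_real_def dist_commute)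
  let ?C = "2 * Cstar_norm f * pi\<^sup>2 / d\<^sup>2"
  have C: "0 \<le> ?C"
    using Cstar_norm_nonneg[OF f] by simp
  have "\<bar>f w - f (x, y)\<bar> \<le> \<epsilon> + ?C * phi x y w" for w
  proof -
    obtain w' where w': "f w' = f w" "(dist w' (x, y))\<^sup>2 \<le> pi\<^sup>2 * phi x y w"
      using Cstar_representative[OF f] by metis
    show ?thesis
    proof (cases "dist w' (x, y) < d")
      case True
      then show ?thesis
        using d(2)[of w'] w'(1) mult_nonneg_nonneg[OF C phi_nonneg[of x y w]] by simp
    next
      case False
      then have "d\<^sup>2 \<le> (dist w' (x, y))\<^sup>2"
        using d(1) by (intro power_mono) auto
      also note w'(2)
      finally have "1 \<le> pi\<^sup>2 * phi x y w / d\<^sup>2"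
        using d(1) by (simp add: field_simps)
      then have "2 * Cstar_norm f * 1 \<le> 2 * Cstar_norm f * (pi\<^sup>2 * phi x y w / d\<^sup>2)"
        using Cstar_norm_nonneg[OF f] by (intro mult_left_mono) auto
      moreover have "\<bar>f w - f (x, y)\<bar> \<le> 2 * Cstar_norm f"
        using Cstar_norm_upper[OF f, of w] Cstar_norm_upper[OF f, of "(x, y)"] by linarith
      ultimately show ?thesis
        using \<open>0 < \<epsilon>\<close> by (simp add: mult.assoc)
    qed
  qed
  with C that show ?thesis by blast
qed

section \<open>Estimates for a single positive operator\<close>

lemma positive_linear_operatorD:
  assumes "positive_linear_operator T" "f \<in> Cstar"
  shows "T f \<in> Cstar"
    and "g \<in> Cstar \<Longrightarrow> T (\<lambda>z. f z + g z) = (\<lambda>z. T f z + T g z)"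
    and "T (\<lambda>z. c * f z) = (\<lambda>z. c * T f z)"
    and "(\<And>z. 0 \<le> f z) \<Longrightarrow> 0 \<le> T f z"
  using assms unfolding positive_linear_operator_def by blast+

lemma positive_linear_operator_mono:
  assumes T: "positive_linear_operator T" and fg: "f \<in> Cstar" "g \<in> Cstar"
    and le: "\<And>w. f w \<le> g w"
  shows "T f z \<le> T g z"
proof -
  have d: "(\<lambda>w. g w - f w) \<in> Cstar"
    by (rule Cstar_diff[OF fg(2,1)])
  have "T (\<lambda>w. f w + (g w - f w)) = (\<lambda>w. T f w + T (\<lambda>w. g w - f w) w)"
    by (rule positive_linear_operatorD(2)[OF T fg(1) d])
  from fun_cong[OF this, of z] have "T g z = T f z + T (\<lambda>w. g w - f w) z"
    by simp
  moreover have "0 \<le> T (\<lambda>w. g w - f w) z"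
    using le by (intro positive_linear_operatorD(4)[OF T d]) simp
  ultimately show ?thesis
    by simp
qed

lemma positive_linear_operator_affine:
  assumes T: "positive_linear_operator T" and h: "h \<in> Cstar"
  shows "T (\<lambda>w. a + b * h w) z = a * T (\<lambda>_. 1) z + b * T h z"
proof -
  have "T (\<lambda>w. a + b * h w) = (\<lambda>z. T (\<lambda>_. a) z + T (\<lambda>w. b * h w) z)"
    by (rule positive_linear_operatorD(2)[OF T Cstar_const Cstar_cmult[OF h]])
  then show ?thesis
    using positive_linear_operatorD(3)[OF T Cstar_const[of 1], of a]
      positive_linear_operatorD(3)[OF T h, of b] by simp
qed

lemma positive_linear_operator_bound:
  assumes T: "positive_linear_operator T" and f: "f \<in> Cstar"
    and B: "\<And>w. \<bar>f w\<bar> \<le> B"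
  shows "\<bar>T f z\<bar> \<le> B * T (\<lambda>_. 1) z"
proof -
  \<comment> \<open>The constants are written as affine expressions in \<open>f\<close> so that
    \<open>positive_linear_operator_affine\<close> evaluates \<open>T\<close> on them.\<close>
  have "T f z \<le> T (\<lambda>w. B + 0 * f w) z" "T (\<lambda>w. - B + 0 * f w) z \<le> T f z"
    using B by (auto intro!: positive_linear_operator_mono[OF T] Cstar_const f
        simp: abs_le_iff minus_le_iff)
  then show ?thesis
    unfolding positive_linear_operator_affine[OF T f] by linarith
qed

text \<open>Used with \<open>c = f z\<close> and \<open>h = phi x y\<close> for
  \<open>z = (x, y)\<close>: the point is frozen while \<open>T\<close> acts in \<open>w\<close>,
  and only then is the result evaluated at \<open>z\<close>.\<close>

lemma positive_linear_operator_local: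
  assumes T: "positive_linear_operator T" and f: "f \<in> Cstar" and h: "h \<in> Cstar"
    and le: "\<And>w. \<bar>f w - c\<bar> \<le> A + B * h w"
  shows "\<bar>T f z - c * T (\<lambda>_. 1) z\<bar> \<le> A * T (\<lambda>_. 1) z + B * T h z"
proof -
  have 1: "(\<lambda>w. (c + A) + B * h w) \<in> Cstar" "(\<lambda>w. (c - A) + (- B) * h w) \<in> Cstar"
    by (intro Cstar_add Cstar_const Cstar_cmult h)+
  have "T f z \<le> T (\<lambda>w. (c + A) + B * h w) z"
    using le by (intro positive_linear_operator_mono[OF T f 1(1)]) (smt (verit))
  moreover have "T (\<lambda>w. (c - A) + (- B) * h w) z \<le> T f z"
    using le by (intro positive_linear_operator_mono[OF T 1(2) f]) (smt (verit) mult_minus_left)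
  ultimately show ?thesis
    unfolding positive_linear_operator_affine[OF T h] by (simp add: algebra_simps abs_le_iff)
qed

text \<open>Since \<open>phi\<close> is at most \<open>2\<close>, the values are bounded by
  \<open>2 * Cstar_norm (T (\<lambda>_. 1))\<close>. The supremum is therefore genuine and
  nonnegative, and squaring undoes the root.\<close>

lemma positive_linear_operator_phi_bound:
  assumes T: "positive_linear_operator T"
    and \<gamma>: "\<gamma> = sqrt (SUP (x, y). \<bar>T (phi x y) (x, y)\<bar>)"
  shows "0 \<le> \<gamma>" and "T (phi x y) (x, y) \<le> \<gamma>\<^sup>2"
proof -
  let ?g = "\<lambda>(x, y). \<bar>T (phi x y) (x, y)\<bar>"
  have "\<bar>T (phi x y) (x, y)\<bar> \<le> 2 * Cstar_norm (T (\<lambda>_. 1))" for x y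
  proof -
    have "\<bar>T (phi x y) (x, y)\<bar> \<le> 2 * T (\<lambda>_. 1) (x, y)"
      using phi_nonneg phi_le_2 by (intro positive_linear_operator_bound[OF T phi_Cstar]) simp
    moreover have "\<bar>T (\<lambda>_. 1) (x, y)\<bar> \<le> Cstar_norm (T (\<lambda>_. 1))"
      by (intro Cstar_norm_upper positive_linear_operatorD(1)[OF T] Cstar_const)
    ultimately show ?thesis by linarith
  qed
  then have "bdd_above (range ?g)"
    by (auto intro!: bdd_aboveI)
  then have up: "\<bar>T (phi x y) (x, y)\<bar> \<le> (SUP z. ?g z)" for x y
    using cSUP_upper[of "(x, y)" UNIV ?g] by simp
  then have S: "0 \<le> (SUP z. ?g z)"
    by (meson abs_ge_zero order_trans)
  then show "0 \<le> \<gamma>"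
    by (simp add: \<gamma>)
  show "T (phi x y) (x, y) \<le> \<gamma>\<^sup>2"
    using up[of x y] S by (simp add: \<gamma>)
qed

text \<open>Splits \<open>T f z - f z\<close> into \<open>T f z - f z * T (\<lambda>_. 1) z\<close>,
  controlled by \<open>phi\<close>, and \<open>f z * (T (\<lambda>_. 1) z - 1)\<close>, controlled
  by \<open>e\<close>. The bound does not depend on \<open>z\<close>, so it passes to the
  norm.\<close>

lemma korovkin_estimate:
  assumes T: "positive_linear_operator T" and f: "f \<in> Cstar"
    and \<gamma>: "\<gamma> = sqrt (SUP (x, y). \<bar>T (phi x y) (x, y)\<bar>)"
  defines "e \<equiv> Cstar_norm (\<lambda>z. T (\<lambda>_. 1) z - 1)"
  shows "Cstar_norm (\<lambda>z. T f z - f z) \<le> modulus f \<gamma> * (1 + e + pi\<^sup>2) + Cstar_norm f * e"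
proof (rule Cstar_norm_least)
  fix z :: "real \<times> real"
  obtain x y where z: "z = (x, y)" by (cases z)
  let ?t = "T (\<lambda>_. 1) z"
  note \<gamma>_nonneg = positive_linear_operator_phi_bound(1)[OF T \<gamma>]
  note phi_le = positive_linear_operator_phi_bound(2)[OF T \<gamma>, of x y, folded z]
  have T1: "T (\<lambda>_. 1) \<in> Cstar"
    by (intro positive_linear_operatorD(1)[OF T] Cstar_const)
  have e: "\<bar>?t - 1\<bar> \<le> e"
    unfolding e_def using Cstar_norm_upper[OF Cstar_diff[OF T1 Cstar_const]] .
  have t: "0 \<le> ?t"
    by (rule positive_linear_operatorD(4)[OF T Cstar_const]) simp
  note \<omega> = modulus_nonneg[OF f \<gamma>_nonneg]
  have main: "\<bar>T f z - f z * ?t\<bar> \<le> modulus f \<gamma> * (?t + pi\<^sup>2)"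
  proof (cases "\<gamma> = 0")
    case False
    with \<gamma>_nonneg have pos: "0 < \<gamma>" by simp
    have "\<bar>T f z - f z * ?t\<bar> \<le> modulus f \<gamma> * ?t + modulus f \<gamma> * pi\<^sup>2 / \<gamma>\<^sup>2 * T (phi x y) z"
      using Cstar_phi_estimate[OF f pos]
      by (intro positive_linear_operator_local[OF T f phi_Cstar]) (simp add: z)
    \<comment> \<open>The choice \<open>\<delta> = \<gamma>\<close> makes the denominator cancel
      against the bound for \<open>T (phi x y) z\<close>.\<close>
    also have "\<dots> \<le> modulus f \<gamma> * ?t + modulus f \<gamma> * pi\<^sup>2 / \<gamma>\<^sup>2 * \<gamma>\<^sup>2"
      using phi_le \<omega> by (intro add_left_mono mult_left_mono) auto
    also have "\<dots> = modulus f \<gamma> * (?t + pi\<^sup>2)"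
      using pos by (simp add: algebra_simps)
    finally show ?thesis .
  next
    case True
    have "\<bar>T f z - f z * ?t\<bar> \<le> 0 + \<eta>" if "0 < \<eta>" for \<eta>
    proof -
      \<comment> \<open>The summand \<open>1\<close> avoids division by zero when
        \<open>?t = 0\<close>.\<close>
      define \<epsilon> where "\<epsilon> = \<eta> / (1 + ?t)"
      have \<epsilon>: "0 < \<epsilon>"
        using that t by (simp add: \<epsilon>_def)
      obtain C where C: "0 \<le> C" "\<And>w. \<bar>f w - f (x, y)\<bar> \<le> \<epsilon> + C * phi x y w"
        using Cstar_phi_estimate_eps[OF f \<epsilon>] by metis
      have "\<bar>T f z - f z * ?t\<bar> \<le> \<epsilon> * ?t + C * T (phi x y) z"
        using C(2) by (intro positive_linear_operator_local[OF T f phi_Cstar]) (simp add: z)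
      \<comment> \<open>With \<open>\<gamma> = 0\<close> the value \<open>T (phi x y) z\<close> is
        at most \<open>0\<close>, so \<open>C\<close> disappears whatever its size.\<close>
      also have "\<dots> \<le> \<epsilon> * ?t"
        using mult_left_mono[OF phi_le C(1)] True by simp
      also have "\<dots> \<le> \<epsilon> * (1 + ?t)"
        using \<epsilon> by (intro mult_left_mono) auto
      also have "\<dots> = 0 + \<eta>"
        using t by (simp add: \<epsilon>_def)
      finally show ?thesis .
    qed
    then have "\<bar>T f z - f z * ?t\<bar> \<le> 0"
      by (rule field_le_epsilon)
    also have "0 \<le> modulus f \<gamma> * (?t + pi\<^sup>2)"
      using \<omega> t by simp
    finally show ?thesis .
  qed
  have "T f z - f z = (T f z - f z * ?t) + f z * (?t - 1)"
    by (simp add: algebra_simps)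
  then have "\<bar>T f z - f z\<bar> \<le> \<bar>T f z - f z * ?t\<bar> + \<bar>f z\<bar> * \<bar>?t - 1\<bar>"
    by (metis abs_mult abs_triangle_ineq)
  also have "\<dots> \<le> modulus f \<gamma> * (1 + e + pi\<^sup>2) + Cstar_norm f * e"
  proof (rule add_mono)
    show "\<bar>T f z - f z * ?t\<bar> \<le> modulus f \<gamma> * (1 + e + pi\<^sup>2)"
      using main e \<omega> by (elim order_trans) (intro mult_left_mono, auto)
    show "\<bar>f z\<bar> * \<bar>?t - 1\<bar> \<le> Cstar_norm f * e"
      using e Cstar_norm_upper[OF f] Cstar_norm_nonneg[OF f] by (intro mult_mono) auto
  qed
  finally show "\<bar>T f z - f z\<bar> \<le> modulus f \<gamma> * (1 + e + pi\<^sup>2) + Cstar_norm f * e" .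
qed

section \<open>Power series means of positive operators\<close>

text \<open>One pair \<open>(r, s)\<close> is fixed, so that the mean becomes a single operator to
  which \<open>korovkin_estimate\<close> applies.\<close>

locale positive_operator_series =
  fixes p :: "nat \<Rightarrow> nat \<Rightarrow> real"
    and L :: "nat \<Rightarrow> nat \<Rightarrow> (real \<times> real \<Rightarrow> real) \<Rightarrow> (real \<times> real \<Rightarrow> real)"
    and r s :: real
  assumes p_nonneg: "0 \<le> p m n"
    and r_nonneg: "0 \<le> r" and s_nonneg: "0 \<le> s"
    and p_series: "dsummable (\<lambda>m n. p m n * r ^ m * s ^ n)"
    and L_pos: "positive_linear_operator (L m n)"
    and L_series: "dsummable (\<lambda>m n. Cstar_norm (L m n (\<lambda>_. 1)) * p m n * r ^ m * s ^ n)"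
begin

lemma L1_Cstar: "L m n (\<lambda>_. 1) \<in> Cstar"
  by (intro positive_linear_operatorD(1)[OF L_pos] Cstar_const)

text \<open>A Weierstrass majorant: it is independent of the evaluation point, hence gives uniform
  as well as absolute convergence.\<close>

definition majorant :: "(real \<times> real \<Rightarrow> real) \<Rightarrow> nat \<times> nat \<Rightarrow> real" where
  "majorant f = (\<lambda>x. Cstar_norm f *
     (case x of (m, n) \<Rightarrow> Cstar_norm (L m n (\<lambda>_. 1)) * p m n * r ^ m * s ^ n))"

lemma majorant_summable: "majorant f summable_on UNIV"
  unfolding majorant_def
proof (rule summable_on_cmult_right, rule dsummable_nonneg_imp_summable_on[OF L_series])
  show "0 \<le> Cstar_norm (L m n (\<lambda>_. 1)) * p m n * r ^ m * s ^ n" for m n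
    using Cstar_norm_nonneg[OF L1_Cstar] p_nonneg r_nonneg s_nonneg by simp
qed

lemma majorant_upper:
  assumes f: "f \<in> Cstar"
  shows "norm (case x of (m, n) \<Rightarrow> L m n f z * p m n * r ^ m * s ^ n) \<le> majorant f x"
proof -
  obtain m n where x: "x = (m, n)" by (cases x)
  have "\<bar>L m n f z\<bar> \<le> Cstar_norm f * L m n (\<lambda>_. 1) z"
    by (intro positive_linear_operator_bound[OF L_pos f] Cstar_norm_upper[OF f])
  also have "\<dots> \<le> Cstar_norm f * Cstar_norm (L m n (\<lambda>_. 1))"
    using Cstar_norm_upper[OF L1_Cstar, of m n z] Cstar_norm_nonneg[OF f]
    by (intro mult_left_mono) auto
  finally have "\<bar>L m n f z\<bar> * (p m n * r ^ m * s ^ n)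
      \<le> Cstar_norm f * Cstar_norm (L m n (\<lambda>_. 1)) * (p m n * r ^ m * s ^ n)"
    using p_nonneg r_nonneg s_nonneg by (intro mult_right_mono) auto
  then show ?thesis
    using p_nonneg r_nonneg s_nonneg by (simp add: x majorant_def abs_mult mult.assoc)
qed

lemma terms_summable_on:
  assumes "f \<in> Cstar"
  shows "(\<lambda>(m, n). L m n f z * p m n * r ^ m * s ^ n) summable_on UNIV"
  using Infinite_Sum.abs_summable_on_comparison_test'[OF majorant_summable majorant_upper[OF assms]]
  by (rule abs_summable_summable)

lemma terms_dsums:
  assumes "f \<in> Cstar"
  shows "dsums (\<lambda>m n. L m n f z * p m n * r ^ m * s ^ n)
    (\<Sum>\<^sub>\<infinity>(m, n). L m n f z * p m n * r ^ m * s ^ n)"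
  by (intro has_sum_imp_dsums has_sum_infsum terms_summable_on assms)

text \<open>Replaces the Pringsheim sum by an unconditional one, for which linearity and positivity
  are available.\<close>

lemma Jp_mean_eq:
  assumes "f \<in> Cstar"
  shows "Jp_mean p (\<lambda>m n. L m n f) r s z =
    1 / dpower p r s * (\<Sum>\<^sub>\<infinity>(m, n). L m n f z * p m n * r ^ m * s ^ n)"
  unfolding Jp_mean_def dsums_imp_dsuminf[OF terms_dsums[OF assms]] ..

lemma dpower_nonneg: "0 \<le> dpower p r s"
proof -
  have nonneg: "0 \<le> p m n * r ^ m * s ^ n" for m n
    using p_nonneg r_nonneg s_nonneg by simp
  have "dpower p r s = (\<Sum>\<^sub>\<infinity>(m, n). p m n * r ^ m * s ^ n)"
    unfolding dpower_def
    by (intro dsums_imp_dsuminf has_sum_imp_dsums has_sum_infsum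
        dsummable_nonneg_imp_summable_on p_series nonneg)
  then show ?thesis
    using nonneg by (auto intro!: infsum_nonneg)
qed

text \<open>The Weierstrass test makes the finite partial sums converge uniformly, so continuity
  survives the limit; periodicity holds term by term.\<close>

lemma Jp_mean_Cstar:
  assumes f: "f \<in> Cstar"
  shows "Jp_mean p (\<lambda>m n. L m n f) r s \<in> Cstar"
proof (rule CstarI)
  let ?F = "\<lambda>x z. case x of (m, n) \<Rightarrow> L m n f z * p m n * r ^ m * s ^ n"
  have Lf: "L m n f \<in> Cstar" for m n
    by (rule positive_linear_operatorD(1)[OF L_pos f])
  have "uniform_limit UNIV (\<lambda>X z. \<Sum>x\<in>X. ?F x z) (\<lambda>z. \<Sum>\<^sub>\<infinity>x. ?F x z) (finite_subsets_at_top UNIV)"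
    by (rule Weierstrass_m_test_general[OF majorant_upper[OF f] majorant_summable])
  moreover have "continuous_on UNIV (\<lambda>z. \<Sum>x\<in>X. ?F x z)" for X
    unfolding case_prod_unfold
    by (intro continuous_on_sum continuous_on_mult_right Cstar_continuous[OF Lf])
  ultimately have "continuous_on UNIV (\<lambda>z. \<Sum>\<^sub>\<infinity>x. ?F x z)"
    by (intro uniform_limit_theorem[where F = "finite_subsets_at_top UNIV"]) auto
  then show "continuous_on UNIV (Jp_mean p (\<lambda>m n. L m n f) r s)"
    unfolding Jp_mean_eq[OF f, abs_def] by (intro continuous_intros)
  show "Jp_mean p (\<lambda>m n. L m n f) r s (x + 2 * of_int k * pi, y + 2 * of_int l * pi) =
      Jp_mean p (\<lambda>m n. L m n f) r s (x, y)" for x y k l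
    by (simp add: Jp_mean_def Cstar_shift[OF Lf])
qed

lemma positive_linear_operator_Jp_mean:
  "positive_linear_operator (\<lambda>f. Jp_mean p (\<lambda>m n. L m n f) r s)"
  unfolding positive_linear_operator_def
proof (intro conjI ballI allI impI)
  fix f assume f: "f \<in> Cstar"
  show "Jp_mean p (\<lambda>m n. L m n f) r s \<in> Cstar"
    by (rule Jp_mean_Cstar[OF f])
  show "Jp_mean p (\<lambda>m n. L m n (\<lambda>z. c * f z)) r s = (\<lambda>z. c * Jp_mean p (\<lambda>m n. L m n f) r s z)" for c
  proof
    fix z
    have "(\<Sum>\<^sub>\<infinity>(m, n). L m n (\<lambda>z. c * f z) z * p m n * r ^ m * s ^ n)
        = (\<Sum>\<^sub>\<infinity>x. c * (case x of (m, n) \<Rightarrow> L m n f z * p m n * r ^ m * s ^ n))"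
      by (intro infsum_cong) (simp add: case_prod_unfold positive_linear_operatorD(3)[OF L_pos f])
    then show "Jp_mean p (\<lambda>m n. L m n (\<lambda>z. c * f z)) r s z = c * Jp_mean p (\<lambda>m n. L m n f) r s z"
      unfolding Jp_mean_eq[OF f] Jp_mean_eq[OF Cstar_cmult[OF f]] infsum_cmult_right' by simp
  qed
  show "Jp_mean p (\<lambda>m n. L m n (\<lambda>z. f z + g z)) r s =
      (\<lambda>z. Jp_mean p (\<lambda>m n. L m n f) r s z + Jp_mean p (\<lambda>m n. L m n g) r s z)"
    if g: "g \<in> Cstar" for g
  proof
    fix z
    have "(\<Sum>\<^sub>\<infinity>(m, n). L m n (\<lambda>z. f z + g z) z * p m n * r ^ m * s ^ n)
        = (\<Sum>\<^sub>\<infinity>x. (case x of (m, n) \<Rightarrow> L m n f z * p m n * r ^ m * s ^ n)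
            + (case x of (m, n) \<Rightarrow> L m n g z * p m n * r ^ m * s ^ n))"
      by (intro infsum_cong)
        (simp add: case_prod_unfold positive_linear_operatorD(2)[OF L_pos f g] algebra_simps)
    also have "\<dots> = (\<Sum>\<^sub>\<infinity>(m, n). L m n f z * p m n * r ^ m * s ^ n)
        + (\<Sum>\<^sub>\<infinity>(m, n). L m n g z * p m n * r ^ m * s ^ n)"
      by (intro infsum_add terms_summable_on f g)
    finally show "Jp_mean p (\<lambda>m n. L m n (\<lambda>z. f z + g z)) r s z =
        Jp_mean p (\<lambda>m n. L m n f) r s z + Jp_mean p (\<lambda>m n. L m n g) r s z"
      unfolding Jp_mean_eq[OF f] Jp_mean_eq[OF g] Jp_mean_eq[OF Cstar_add[OF f g]]
      by (simp add: distrib_left)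
  qed
  fix z assume "\<forall>z. 0 \<le> f z"
  then have "0 \<le> L m n f z" for m n
    by (intro positive_linear_operatorD(4)[OF L_pos f]) blast
  then show "0 \<le> Jp_mean p (\<lambda>m n. L m n f) r s z"
    unfolding Jp_mean_eq[OF f] using p_nonneg r_nonneg s_nonneg dpower_nonneg
    by (intro mult_nonneg_nonneg infsum_nonneg) auto
qed

end

theorem theorem2p2:
  fixes p :: "nat \<Rightarrow> nat \<Rightarrow> real"
    and L :: "nat \<Rightarrow> nat \<Rightarrow> (real \<times> real \<Rightarrow> real) \<Rightarrow> (real \<times> real \<Rightarrow> real)"
    and f :: "real \<times> real \<Rightarrow> real"
  assumes p_nonneg: "\<And>m n. 0 \<le> p m n"
    and p_00: "0 < p 0 0"
    and p_diverges: "filterlim (dpartial p) at_top (sequentially \<times>\<^sub>F sequentially)"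
    and p_series: "\<And>r s. r \<in> {0<..<1} \<Longrightarrow> s \<in> {0<..<1} \<Longrightarrow>
      dsummable (\<lambda>m n. p m n * r ^ m * s ^ n)"
    and L_pos: "\<And>m n. positive_linear_operator (L m n)"
    and L_series: "\<And>r s. r \<in> {0<..<1} \<Longrightarrow> s \<in> {0<..<1} \<Longrightarrow>
      dsummable (\<lambda>m n. Cstar_norm (L m n (\<lambda>_. 1)) * p m n * r ^ m * s ^ n)"
    and f: "f \<in> Cstar"
    and i: "Jp_summable p (\<lambda>m n. L m n (\<lambda>_. 1)) (\<lambda>_. 1)"
    and ii: "((\<lambda>(r, s). modulus f (gamma_rs p L r s)) \<longlongrightarrow> 0) (at_left 1 \<times>\<^sub>F at_left 1)"
  shows "Jp_summable p (\<lambda>m n. L m n f) f"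
proof -
  define T where "T r s = (\<lambda>g. Jp_mean p (\<lambda>m n. L m n g) r s)" for r s
  define e where "e r s = Cstar_norm (\<lambda>z. T r s (\<lambda>_. 1) z - 1)" for r s
  define \<gamma> where "\<gamma> r s = gamma_rs p L r s" for r s
  let ?F = "at_left 1 \<times>\<^sub>F at_left 1 :: (real \<times> real) filter"
  have series: "positive_operator_series p L r s" if "r \<in> {0<..<1}" "s \<in> {0<..<1}" for r s
    using that p_nonneg p_series L_pos L_series by unfold_locales auto
  have T: "positive_linear_operator (T r s)" if "r \<in> {0<..<1}" "s \<in> {0<..<1}" for r s
    unfolding T_def
    by (rule positive_operator_series.positive_linear_operator_Jp_mean[OF series[OF that]])
  \<comment> \<open>Unfolding definitions shows that \<open>gamma_rs\<close> already has the form
    that \<open>korovkin_estimate\<close> expects for \<open>T r s\<close>.\<close>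
  have gamma_eq: "\<gamma> r s = sqrt (SUP (x, y). \<bar>T r s (phi x y) (x, y)\<bar>)" for r s
    by (simp add: \<gamma>_def T_def gamma_rs_def Jp_mean_def)
  have e0: "((\<lambda>(r, s). e r s) \<longlongrightarrow> 0) ?F"
    using i by (simp add: Jp_summable_def e_def T_def)
  have \<omega>0: "((\<lambda>(r, s). modulus f (\<gamma> r s)) \<longlongrightarrow> 0) ?F"
    using ii by (simp add: \<gamma>_def)
  have "((\<lambda>(r, s). Cstar_norm (\<lambda>z. T r s f z - f z)) \<longlongrightarrow> 0) ?F"
  proof (rule tendsto_sandwich)
    \<comment> \<open>The estimates hold only on the open unit square, where \<open>(r, s)\<close>
      eventually lies; the same fact serves both factors of the product filter.\<close>
    have "\<forall>\<^sub>F r in at_left 1. r \<in> {0<..<1::real}"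
      by (rule eventually_at_left_real) simp
    then have unit: "\<forall>\<^sub>F x in ?F. fst x \<in> {0<..<1} \<and> snd x \<in> {0<..<1}"
      by (rule eventually_prodI) fact
    then show "\<forall>\<^sub>F x in ?F. 0 \<le> (case x of (r, s) \<Rightarrow> Cstar_norm (\<lambda>z. T r s f z - f z))"
      by eventually_elim
        (auto intro!: Cstar_norm_nonneg Cstar_diff positive_linear_operatorD(1)[OF T] f)
    show "\<forall>\<^sub>F x in ?F. (case x of (r, s) \<Rightarrow> Cstar_norm (\<lambda>z. T r s f z - f z))
        \<le> (case x of (r, s) \<Rightarrow> modulus f (\<gamma> r s)) * (1 + (case x of (r, s) \<Rightarrow> e r s) + pi\<^sup>2)
          + Cstar_norm f * (case x of (r, s) \<Rightarrow> e r s)"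
      using unit
    proof eventually_elim
      case (elim x)
      then show ?case
        using korovkin_estimate[OF T f gamma_eq, of "fst x" "snd x"]
        by (simp add: case_prod_unfold e_def)
    qed
    show "((\<lambda>x. (case x of (r, s) \<Rightarrow> modulus f (\<gamma> r s)) * (1 + (case x of (r, s) \<Rightarrow> e r s) + pi\<^sup>2)
          + Cstar_norm f * (case x of (r, s) \<Rightarrow> e r s)) \<longlongrightarrow> 0) ?F"
      using tendsto_add[OF tendsto_mult[OF \<omega>0 tendsto_add[OF tendsto_add[OF tendsto_const e0]
        tendsto_const]] tendsto_mult[OF tendsto_const e0], of 1 "pi\<^sup>2" "Cstar_norm f"] by simp
  qed simp
  \<comment> \<open>What remains is the first conjunct of \<open>Jp_summable\<close>: the means of
    \<open>f\<close> are well defined and lie in \<open>Cstar\<close>.\<close>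
  moreover have "dsummable (\<lambda>m n. L m n f z * p m n * r ^ m * s ^ n)"
    if "r \<in> {0<..<1}" "s \<in> {0<..<1}" for r s z
    using positive_operator_series.terms_dsums[OF series[OF that] f] unfolding dsummable_def by blast
  moreover have "T r s f \<in> Cstar" if "r \<in> {0<..<1}" "s \<in> {0<..<1}" for r s
    by (rule positive_linear_operatorD(1)[OF T[OF that] f])
  ultimately show ?thesis
    unfolding Jp_summable_def T_def by blast
qed

end
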